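(* We have $h_{OD}(S_{625})\geq 6$. In particular, it is not true that every symmetric group $S_m$ with $m\neq 10$ is $n$-fold OD-characterizable for some $n\in\{1,3\}$.
   Context: All groups are finite. $S_n$ denotes the symmetric group of degree $n$. For a finite group $G$, $\pi(G)$ is the set of prime divisors of $|G|$. The prime graph $GK(G)$ is the graph with vertex set $\pi(G)$ in which two distinct primes $r,s\in\pi(G)$ are adjacent if and only if $G$ contains an element of order $rs$. Writing $\pi(G)=\{p_1,\ldots,p_k\}$ with $p_1<p_2<\cdots<p_k$, the degree pattern of $G$ is the tuple $D(G)=(\deg(p_1),\deg(p_2),\ldots,\deg(p_k))$, where $\deg(p_i)$ is the degree of the vertex $p_i$ in $GK(G)$. For a finite group $G$, $h_{OD}(G)$ denotes the number of pairwise nonisomorphic finite groups $H$ (i.e. the number of isomorphism classes, including that of $G$ itself) such that $|H|=|G|$ and $D(H)=D(G)$. The group $G$ is called $k$-fold OD-characterizable if $h_{OD}(G)=k$. *)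

theory Defs
  imports "HOL-Algebra.Sym_Groups" "HOL-Algebra.Multiplicative_Group"
    "HOL-Computational_Algebra.Primes" "HOL-Library.FuncSet"
begin

text \<open>The prime graph (Gruenberg--Kegel graph) of a finite group.\<close>

definition prime_graph_verts :: "('a, 'b) monoid_scheme \<Rightarrow> nat set" where
  "prime_graph_verts G = {p. prime p \<and> p dvd order G}"

definition prime_graph_adj :: "('a, 'b) monoid_scheme \<Rightarrow> nat \<Rightarrow> nat \<Rightarrow> bool" where
  "prime_graph_adj G r s \<longleftrightarrow>
     r \<in> prime_graph_verts G \<and> s \<in> prime_graph_verts G \<and> r \<noteq> s \<and>
     (\<exists>x\<in>carrier G. group.ord G x = r * s)"

definition prime_graph_degree :: "('a, 'b) monoid_scheme \<Rightarrow> nat \<Rightarrow> nat" where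
  "prime_graph_degree G p = card {q. prime_graph_adj G p q}"

definition degree_pattern :: "('a, 'b) monoid_scheme \<Rightarrow> nat list" where
  "degree_pattern G = map (prime_graph_degree G) (sorted_list_of_set (prime_graph_verts G))"

text \<open>
  Groups are counted up to isomorphism among those with carrier a finite set of natural
  numbers. Every finite group is isomorphic to one of these (lemma \<open>finite_group_iso_nat\<close>
  below), so no isomorphism class is lost by fixing the type.
\<close>

definition OD_groups :: "('a, 'b) monoid_scheme \<Rightarrow> nat monoid set" where
  "OD_groups G = {H. group H \<and> finite (carrier H) \<and> order H = order G \<and>
                     degree_pattern H = degree_pattern G}"

definition OD_iso_rel :: "('a, 'b) monoid_scheme \<Rightarrow> (nat monoid \<times> nat monoid) set" where
  "OD_iso_rel G = {(H, K). H \<in> OD_groups G \<and> K \<in> OD_groups G \<and> H \<cong> K}"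

definition h_OD :: "('a, 'b) monoid_scheme \<Rightarrow> nat" where
  "h_OD G = card (OD_groups G // OD_iso_rel G)"

definition fold_OD_characterizable :: "nat \<Rightarrow> ('a, 'b) monoid_scheme \<Rightarrow> bool" where
  "fold_OD_characterizable k G \<longleftrightarrow> h_OD G = k"

lemma equiv_OD_iso_rel: "equiv (OD_groups G) (OD_iso_rel G)"
proof (rule equivI)
  show "OD_iso_rel G \<subseteq> OD_groups G \<times> OD_groups G"
    by (auto simp: OD_iso_rel_def)
  show "refl_on (OD_groups G) (OD_iso_rel G)"
    by (auto simp: OD_iso_rel_def refl_on_def)
  show "sym (OD_iso_rel G)"
    by (auto simp: OD_iso_rel_def OD_groups_def sym_def intro: group.iso_sym)
  show "trans (OD_iso_rel G)"
    by (auto simp: OD_iso_rel_def trans_def intro: iso_trans)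
qed

lemma finite_group_iso_nat:
  assumes "group G" and "finite (carrier G)"
  obtains f :: "nat \<times> nat \<Rightarrow> nat" and e :: nat
  where "f \<in> ({..<order G} \<times> {..<order G}) \<rightarrow>\<^sub>E {..<order G}" and "e < order G"
    and "group \<lparr>carrier = {..<order G}, mult = \<lambda>x y. f (x, y), one = e\<rparr>"
    and "G \<cong> \<lparr>carrier = {..<order G}, mult = \<lambda>x y. f (x, y), one = e\<rparr>"
proof -
  interpret G: group G by fact
  define A where "A = {..<order G}"
  obtain h where h: "bij_betw h (carrier G) A"
    using ex_bij_betw_finite_nat[OF assms(2)]
    by (auto simp: A_def order_def atLeast0LessThan)
  define g where "g = inv_into (carrier G) h"
  have g: "g a \<in> carrier G" "h (g a) = a" if "a \<in> A" for a
    using that h unfolding g_def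
    by (auto simp: bij_betw_def inv_into_into f_inv_into_f)
  have gh: "g (h x) = x" "h x \<in> A" if "x \<in> carrier G" for x
    using that h unfolding g_def by (auto simp: bij_betw_def)
  define f where "f = restrict (\<lambda>(a, b). h (g a \<otimes>\<^bsub>G\<^esub> g b)) (A \<times> A)"
  define e where "e = h \<one>\<^bsub>G\<^esub>"
  define H where "H = \<lparr>carrier = A, mult = \<lambda>x y. f (x, y), one = e\<rparr>"
  have fab: "f (a, b) = h (g a \<otimes>\<^bsub>G\<^esub> g b)" if "a \<in> A" "b \<in> A" for a b
    using that by (simp add: f_def)
  have f: "f \<in> (A \<times> A) \<rightarrow>\<^sub>E A"
    unfolding f_def by (auto intro!: gh(2) G.m_closed g(1))
  have e: "e \<in> A" unfolding e_def using gh(2) by blast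
  have fA: "f (a, b) \<in> A" if "a \<in> A" "b \<in> A" for a b
    using PiE_mem[OF f] that by blast
  have gf: "g (f (a, b)) = g a \<otimes>\<^bsub>G\<^esub> g b" if "a \<in> A" "b \<in> A" for a b
    using that g(1) fab gh(1) by simp
  have "group H"
  proof (rule groupI)
    show "\<exists>y\<in>carrier H. y \<otimes>\<^bsub>H\<^esub> x = \<one>\<^bsub>H\<^esub>" if "x \<in> carrier H" for x
    proof -
      have x: "x \<in> A" using that by (simp add: H_def)
      have "h (inv\<^bsub>G\<^esub> (g x)) \<in> A" using gh(2) g(1)[OF x] by blast
      moreover have "f (h (inv\<^bsub>G\<^esub> (g x)), x) = e"
        using x calculation g(1)[OF x] fab gh(1) by (simp add: e_def)
      ultimately show ?thesis by (auto simp: H_def)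
    qed
    show "x \<otimes>\<^bsub>H\<^esub> y \<otimes>\<^bsub>H\<^esub> z = x \<otimes>\<^bsub>H\<^esub> (y \<otimes>\<^bsub>H\<^esub> z)"
      if "x \<in> carrier H" "y \<in> carrier H" "z \<in> carrier H" for x y z
    proof -
      have xyz: "x \<in> A" "y \<in> A" "z \<in> A" using that by (auto simp: H_def)
      have "f (f (x, y), z) = f (x, f (y, z))"
        using xyz fA[OF xyz(1,2)] fA[OF xyz(2,3)] gf[OF xyz(1,2)] gf[OF xyz(2,3)] fab g(1)
        by (simp add: G.m_assoc)
      then show ?thesis by (simp add: H_def)
    qed
    show "\<one>\<^bsub>H\<^esub> \<otimes>\<^bsub>H\<^esub> x = x" if "x \<in> carrier H" for x
    proof -
      have x: "x \<in> A" using that by (simp add: H_def)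
      have "f (e, x) = x" using x e fab gh(1) g by (simp add: e_def)
      then show ?thesis by (simp add: H_def)
    qed
  qed (use e fA in \<open>auto simp: H_def\<close>)
  moreover have "h \<in> iso G H"
    using h gh fab unfolding iso_def hom_def by (auto simp: H_def)
  then have "G \<cong> H" by (rule is_isoI)
  ultimately show ?thesis using that f e by (auto simp: H_def A_def)
qed

text \<open>In particular \<open>h_OD\<close> is never the default value of \<open>card\<close> on an infinite set.\<close>

lemma finite_OD_classes: "finite (OD_groups G // OD_iso_rel G)"
proof -
  let ?n = "order G"
  define T where "T = (\<lambda>(f, e). \<lparr>carrier = {..<?n}, mult = \<lambda>x y. f (x, y), one = e\<rparr> :: nat monoid)"
  define C where "C = (\<lambda>t. {K \<in> OD_groups G. K \<cong> T t})"
  have "OD_groups G // OD_iso_rel G \<subseteq> C ` ((({..<?n} \<times> {..<?n}) \<rightarrow>\<^sub>E {..<?n}) \<times> {..<?n})"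
  proof
    fix X assume "X \<in> OD_groups G // OD_iso_rel G"
    then obtain H where H: "H \<in> OD_groups G" and X: "X = OD_iso_rel G `` {H}"
      by (auto simp: quotient_def)
    then have "group H" "finite (carrier H)" "order H = ?n" by (auto simp: OD_groups_def)
    then obtain f e where fe: "f \<in> ({..<?n} \<times> {..<?n}) \<rightarrow>\<^sub>E {..<?n}" "e < ?n"
      and gT: "group (T (f, e))" and iso: "H \<cong> T (f, e)"
      by - (rule finite_group_iso_nat[of H], simp_all add: T_def)
    have "H \<cong> K \<longleftrightarrow> K \<cong> T (f, e)" if "K \<in> OD_groups G" for K
      using that \<open>group H\<close> iso gT group.iso_sym iso_trans unfolding OD_groups_def by blast
    then have "X = C (f, e)" using H by (auto simp: X C_def OD_iso_rel_def)
    then show "X \<in> C ` ((({..<?n} \<times> {..<?n}) \<rightarrow>\<^sub>E {..<?n}) \<times> {..<?n})" using fe by blast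
  qed
  then show ?thesis by (rule finite_subset) (auto intro!: finite_PiE)
qed

end

theory Submission
  imports Defs "HOL-Algebra.Elementary_Groups"
begin

text \<open>
  Distinct primes \<open>r\<close> and \<open>s\<close> are adjacent in the prime graph of \<open>S\<^sub>n\<close> iff \<open>r + s \<le> n\<close>. If
  \<open>r + s = 625\<close>, one of them is \<open>2\<close> and the other is \<open>623 = 7 \<cdot> 89\<close>, so \<open>S\<^sub>6\<^sub>2\<^sub>4\<close> and
  \<open>S\<^sub>6\<^sub>2\<^sub>5\<close> have the same prime graph; and since there is no prime in \<open>[620, 625]\<close>, the vertex
  \<open>5\<close> is adjacent to all others. Hence multiplying \<open>S\<^sub>6\<^sub>2\<^sub>4\<close> by any group \<open>K\<close> of order \<open>5\<^sup>4\<close>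
  changes nothing, and \<open>S\<^sub>6\<^sub>2\<^sub>4 \<times> K\<close> has the order and degree pattern of \<open>S\<^sub>6\<^sub>2\<^sub>5\<close>. The five
  abelian choices of \<open>K\<close> are the centres of the respective products, whereas \<open>S\<^sub>6\<^sub>2\<^sub>5\<close> is
  centreless.
\<close>

section \<open>Prime graphs of symmetric groups\<close>

text \<open>\<open>m\<close> splits into a divisor of \<open>r\<close> times a divisor of
  \<open>s\<close>, each 1 or the whole prime; unless both are whole, \<open>m\<close> divides
  \<open>r\<close> or \<open>s\<close>. Applied to element orders and to cycle lengths.\<close>

lemma eq_prime_prod_if_dvd:
  fixes r s m :: nat
  assumes "prime r" "prime s" "m dvd r * s" "\<not> m dvd r" "\<not> m dvd s"
  shows "m = r * s"
proof -
  obtain a b where ab: "m = a * b" "a dvd r" "b dvd s"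
    using division_decomp[OF assms(3)] by blast
  then have "a = 1 \<or> a = r" "b = 1 \<or> b = s"
    using assms(1,2) by (auto simp: prime_nat_iff)
  then show ?thesis using ab assms(4,5) by auto
qed

lemma sym_group_pow: "x [^]\<^bsub>sym_group n\<^esub> (k::nat) = x ^^ k"
  by (induction k)
    (auto simp: nat_pow_def sym_group_def funpow_swap1 fun_eq_iff)

text \<open>The k-th power of the cycle rotates \<open>cs\<close> by k places and fixes all other
  points. As the entries are distinct, the first entry returns to its place only when
  \<open>length cs\<close> divides k.\<close>

lemma ord_cycle_of_list:
  assumes "cycle cs" "cs \<noteq> []" "set cs \<subseteq> {1..n}"
  shows "group.ord (sym_group n) (cycle_of_list cs) = length cs"
proof -
  interpret group "sym_group n" by (rule sym_group_is_group)
  let ?c = "cycle_of_list cs"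
  have carr: "?c \<in> carrier (sym_group n)"
    using permutes_subset[OF cycle_permutes assms(3)] by (simp add: sym_group_carrier)
  have "?c ^^ k = id \<longleftrightarrow> length cs dvd k" for k
  proof
    assume "?c ^^ k = id"
    then have "rotate k cs = cs"
      using cyclic_rotation[OF assms(1), of k] by simp
    then have "cs ! (k mod length cs) = cs ! 0"
      using nth_rotate[of 0 cs k] assms(2) by simp
    then have "k mod length cs = 0"
      using assms(1,2) by (simp add: nth_eq_iff_index_eq)
    then show "length cs dvd k" by auto
  next
    assume "length cs dvd k"
    then have "map (?c ^^ k) cs = cs"
      using cyclic_rotation[OF assms(1), of k] by (simp add: rotate_id)
    then have "(?c ^^ k) x = x" if "x \<in> set cs" for x
      using that by (metis map_eq_conv map_ident)
    moreover have "(?c ^^ k) x = x" if "x \<notin> set cs" for x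
      using permutes_funpow[OF cycle_permutes, of k cs] that by (simp add: permutes_def)
    ultimately show "?c ^^ k = id" by (auto simp: fun_eq_iff)
  qed
  then show ?thesis
    using ord_unique[OF carr, of "length cs"] by (simp add: sym_group_pow sym_group_one)
qed

lemma sym_group_ex_ord_prime_prod:
  assumes "prime r" "prime s" "r \<noteq> s" "r + s \<le> n"
  shows "\<exists>x\<in>carrier (sym_group n). group.ord (sym_group n) x = r * s"
proof -
  interpret group "sym_group n" by (rule sym_group_is_group)
  \<comment> \<open>Two disjoint blocks of lengths \<open>r\<close> and \<open>s\<close>; they fit
    into {1..n} because r + s \<le> n.\<close>
  define cs where "cs = [1..<r+1]"
  define ds where "ds = [r+1..<r+s+1]"
  let ?c = "cycle_of_list cs" and ?d = "cycle_of_list ds"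
  have pos: "r > 0" "s > 0" using assms by (auto simp: prime_gt_0_nat)
  have cs: "cycle cs" "cs \<noteq> []" "set cs \<subseteq> {1..n}" "length cs = r"
    using pos assms(4) by (auto simp: cs_def)
  have ds: "cycle ds" "ds \<noteq> []" "set ds \<subseteq> {1..n}" "length ds = s"
    using pos assms(4) by (auto simp: ds_def)
  have "?c \<circ> ?d = ?d \<circ> ?c"
    by (rule cycles_commute) (auto simp: cs_def ds_def)
  then have comm: "?c \<otimes>\<^bsub>sym_group n\<^esub> ?d = ?d \<otimes>\<^bsub>sym_group n\<^esub> ?c"
    by (simp add: sym_group_mult)
  have carr: "?c \<in> carrier (sym_group n)" "?d \<in> carrier (sym_group n)"
    using permutes_subset[OF cycle_permutes cs(3)] permutes_subset[OF cycle_permutes ds(3)]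
    by (auto simp: sym_group_carrier)
  have ord: "ord ?c = r" "ord ?d = s"
    using ord_cycle_of_list cs ds by auto
  have pw: "(?c \<otimes>\<^bsub>sym_group n\<^esub> ?d) [^]\<^bsub>sym_group n\<^esub> k
      = ?c [^]\<^bsub>sym_group n\<^esub> k \<otimes>\<^bsub>sym_group n\<^esub> ?d [^]\<^bsub>sym_group n\<^esub> k" for k :: nat
    by (rule pow_mult_distrib[OF comm carr])
  \<comment> \<open>The r-th power of the product is the r-th power of the s-cycle alone, which is
    nontrivial; symmetrically for s. So the order of the product divides neither prime.\<close>
  have ndvd: "\<not> s dvd r" "\<not> r dvd s"
    using assms primes_dvd_imp_eq by blast+
  have "?c [^]\<^bsub>sym_group n\<^esub> r = \<one>\<^bsub>sym_group n\<^esub>" "?d [^]\<^bsub>sym_group n\<^esub> s = \<one>\<^bsub>sym_group n\<^esub>"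
    "?d [^]\<^bsub>sym_group n\<^esub> r \<noteq> \<one>\<^bsub>sym_group n\<^esub>" "?c [^]\<^bsub>sym_group n\<^esub> s \<noteq> \<one>\<^bsub>sym_group n\<^esub>"
    using carr ord ndvd by (simp_all add: pow_eq_id)
  then have "(?c \<otimes>\<^bsub>sym_group n\<^esub> ?d) [^]\<^bsub>sym_group n\<^esub> r \<noteq> \<one>\<^bsub>sym_group n\<^esub>"
    "(?c \<otimes>\<^bsub>sym_group n\<^esub> ?d) [^]\<^bsub>sym_group n\<^esub> s \<noteq> \<one>\<^bsub>sym_group n\<^esub>"
    unfolding pw using carr by simp_all
  then have "\<not> ord (?c \<otimes>\<^bsub>sym_group n\<^esub> ?d) dvd r" "\<not> ord (?c \<otimes>\<^bsub>sym_group n\<^esub> ?d) dvd s"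
    using carr by (simp_all add: pow_eq_id)
  moreover have "ord (?c \<otimes>\<^bsub>sym_group n\<^esub> ?d) dvd r * s"
    using ord_mul_divides[OF comm carr] ord by simp
  ultimately have "ord (?c \<otimes>\<^bsub>sym_group n\<^esub> ?d) = r * s"
    using eq_prime_prod_if_dvd assms by blast
  then show ?thesis using carr by blast
qed

text \<open>Some point x lies on a cycle whose length does not divide \<open>r\<close>, and some y
  on one whose length does not divide \<open>s\<close>. Either one of these cycles has length r * s
  \<ge> r + s, or they have lengths s and r and are disjoint.\<close>

lemma sum_le_if_ord_eq_prime_prod:
  assumes "prime r" "prime s" "r \<noteq> s"
    and p: "p \<in> carrier (sym_group n)" "group.ord (sym_group n) p = r * s"
  shows "r + s \<le> n"
proof -
  interpret group "sym_group n" by (rule sym_group_is_group)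
  have perm: "p permutes {1..n}" "permutation p"
    using p(1) sym_group_carrier' by (auto simp: sym_group_carrier)
  have pow: "p ^^ k = id \<longleftrightarrow> r * s dvd k" for k
    using pow_eq_id[OF p(1), of k] p(2) by (simp add: sym_group_pow sym_group_one)
  \<comment> \<open>\<open>?l z\<close> is the length of the cycle of \<open>p\<close> through z,
    and \<open>?O z\<close> is its set of points.\<close>
  let ?l = "least_power p"
  let ?O = "\<lambda>x. set (support p x)"
  have ge2: "r \<ge> 2" "s \<ge> 2" using assms by (auto simp: prime_ge_2_nat)
  have "p ^^ r \<noteq> id" "p ^^ s \<noteq> id" "p ^^ (r * s) = id"
    using pow ge2 by (auto dest!: dvd_imp_le)
  then obtain x y where xy: "(p ^^ r) x \<noteq> x" "(p ^^ s) y \<noteq> y" and rs: "\<And>z. (p ^^ (r * s)) z = z"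
    by (auto simp: fun_eq_iff)
  have dvd: "?l x dvd r * s" "?l y dvd r * s" "\<not> ?l x dvd r" "\<not> ?l y dvd s"
    using xy rs least_power_dvd[OF perm(2)] by auto
  have sub: "?O z \<subseteq> {1..n}" if "(p ^^ k) z \<noteq> z" for z k
  proof -
    have "z \<in> {1..n}"
      using permutes_funpow[OF perm(1), of k] that by (auto simp: permutes_def)
    then show ?thesis
      using permutes_in_image[OF permutes_funpow[OF perm(1)]] by fastforce
  qed
  have card_O: "card (?O z) = ?l z" for z
    using distinct_card[OF cycle_of_permutation[OF perm(2), of z]] by simp
  have le: "?l x \<le> n" "?l y \<le> n"
    using card_mono[OF _ sub[OF xy(1)]] card_mono[OF _ sub[OF xy(2)]] card_O by auto
  have rs_le: "r + s \<le> r * s"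
  proof -
    obtain a b where "r = a + 2" "s = b + 2" using ge2 by (metis add.commute le_Suc_ex)
    then show ?thesis by (simp add: algebra_simps)
  qed
  show ?thesis
  proof (cases "?l x = r * s \<or> ?l y = r * s")
    case True
    then show ?thesis using le rs_le by auto
  next
    case False
    then have "?l x dvd s" "?l y dvd r"
      using eq_prime_prod_if_dvd assms(1,2) dvd by blast+
    moreover have "?l x \<noteq> 1" "?l y \<noteq> 1" using dvd(3,4) by auto
    ultimately have l: "?l x = s" "?l y = r"
      using assms(1,2) by (auto simp: prime_nat_iff)
    \<comment> \<open>Cycles of different lengths are different, and different cycles are
      disjoint.\<close>
    then have "?O x \<noteq> ?O y" using card_O assms(3) by metis
    then have "?O x \<inter> ?O y = {}"
      using disjoint_support[OF perm(2)] unfolding disjoint_def by blast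
    then have "card (?O x \<union> ?O y) = card (?O x) + card (?O y)"
      by (intro card_Un_disjoint finite_set)
    also have "\<dots> = r + s"
      unfolding card_O by (simp add: l)
    finally have "card (?O x \<union> ?O y) = r + s" .
    moreover have "card (?O x \<union> ?O y) \<le> card {1..n}"
      using sub[OF xy(1)] sub[OF xy(2)] by (intro card_mono) auto
    ultimately show ?thesis by simp
  qed
qed

lemma prime_graph_verts_sym_group: "prime_graph_verts (sym_group n) = {p. prime p \<and> p \<le> n}"
  by (auto simp: prime_graph_verts_def order_def sym_group_card_carrier prime_dvd_fact_iff)

lemma prime_graph_adj_sym_group:
  "prime_graph_adj (sym_group n) r s \<longleftrightarrow> prime r \<and> prime s \<and> r \<noteq> s \<and> r + s \<le> n"
  using sym_group_ex_ord_prime_prod[of r s n] sum_le_if_ord_eq_prime_prod[of r s _ n]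
  by (auto simp: prime_graph_adj_def prime_graph_verts_sym_group)

section \<open>Direct products\<close>

lemma DirProd_pow:
  "(x, y) [^]\<^bsub>G \<times>\<times> H\<^esub> (n::nat) = (x [^]\<^bsub>G\<^esub> n, y [^]\<^bsub>H\<^esub> n)"
  by (induction n) (auto simp: nat_pow_def)

lemma order_DirProd: "order (G \<times>\<times> H) = order G * order H"
  by (simp add: order_def card_cartesian_product)

lemma ord_DirProd_dvd_iff:
  assumes "group G" "group H" "x \<in> carrier G" "y \<in> carrier H"
  shows "group.ord (G \<times>\<times> H) (x, y) dvd n \<longleftrightarrow> group.ord G x dvd n \<and> group.ord H y dvd n"
proof -
  interpret G: group G by fact
  interpret H: group H by fact
  interpret GH: group "G \<times>\<times> H" by (rule DirProd_group[OF assms(1,2)])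
  show ?thesis
    using assms(3,4) by (simp add: DirProd_pow flip: G.pow_eq_id H.pow_eq_id GH.pow_eq_id)
qed

lemma ord_DirProd:
  assumes "group G" "group H" "x \<in> carrier G" "y \<in> carrier H"
  shows "group.ord (G \<times>\<times> H) (x, y) = lcm (group.ord G x) (group.ord H y)"
proof (rule dvd_antisym)
  show "group.ord (G \<times>\<times> H) (x, y) dvd lcm (group.ord G x) (group.ord H y)"
    by (subst ord_DirProd_dvd_iff[OF assms]) simp
  show "lcm (group.ord G x) (group.ord H y) dvd group.ord (G \<times>\<times> H) (x, y)"
    using ord_DirProd_dvd_iff[OF assms, THEN iffD1, OF dvd_refl] by (simp only: lcm_least)
qed

section \<open>The products of S_624 with groups of order 625\<close>

lemma order_sym_group_DirProd:
  assumes "order K = Suc n"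
  shows "order (sym_group n \<times>\<times> K) = order (sym_group (Suc n))"
  \<comment> \<open>This is (n+1)! = (n+1) n!; with \<open>n\<close> symbolic, no factorial of a
    numeral is evaluated.\<close>
  by (simp add: order_DirProd assms) (simp add: order_def sym_group_card_carrier)

lemma order_sym_group_624_DirProd:
  assumes "order K = 625"
  shows "order (sym_group 624 \<times>\<times> K) = order (sym_group 625)"
  using order_sym_group_DirProd[of K 624] assms by (simp only: Suc_numeral semiring_norm)

text \<open>Each of 620, ..., 625 has a factor among 2, 3, 5, 7. The bound is just strong enough: 5
  + 619 = 624.\<close>

lemma prime_le_625D:
  assumes "prime p" "p \<le> (625::nat)"
  shows "p \<le> 619"
proof (rule ccontr)
  assume "\<not> p \<le> 619"
  then have "p \<in> {620, 621, 622, 623, 624, 625}" using assms(2) by auto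
  moreover have "2 dvd (620::nat)" "3 dvd (621::nat)" "2 dvd (622::nat)" "7 dvd (623::nat)"
    "2 dvd (624::nat)" "5 dvd (625::nat)" by simp_all
  ultimately have "\<exists>d\<in>{2, 3, 5, 7}. d dvd p" by auto
  then show False using assms \<open>\<not> p \<le> 619\<close> by (auto simp: prime_nat_iff)
qed

lemma prime_add_ne_625:
  assumes "prime r" "prime s"
  shows "r + s \<noteq> (625::nat)"
proof
  assume sum: "r + s = 625"
  then have "even r \<or> even s" by presburger
  then have "r = 2 \<or> s = 2" using assms primes_dvd_imp_eq two_is_prime_nat by metis
  then have "r = 623 \<or> s = 623" using sum by arith
  then show False using prime_le_625D[OF assms(1)] prime_le_625D[OF assms(2)] by auto
qed

lemma prime_graph_adj_sym_group_625_iff: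
  "prime_graph_adj (sym_group 625) r s \<longleftrightarrow> prime_graph_adj (sym_group 624) r s"
  using prime_add_ne_625[of r s] by (auto simp: prime_graph_adj_sym_group)

text \<open>Only 5 divides the order of \<open>K\<close>, so \<open>K\<close> could create new edges
  only at the vertex 5, which is already joined to all others. \<open>K\<close> need not be
  abelian.\<close>

lemma prime_graph_adj_sym_group_624_DirProd:
  assumes K: "group K" "order K = 625"
  shows "prime_graph_adj (sym_group 624 \<times>\<times> K) r s \<longleftrightarrow> prime_graph_adj (sym_group 624) r s"
    (is "prime_graph_adj ?H r s \<longleftrightarrow> _")
proof
  interpret S: group "sym_group 624" by (rule sym_group_is_group)
  interpret K: group K by fact
  note ord = ord_DirProd[OF sym_group_is_group K(1)]
  have verts: "prime_graph_verts ?H = prime_graph_verts (sym_group 625)"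
    by (simp only: prime_graph_verts_def order_sym_group_624_DirProd[OF K(2)])
  {
    assume "prime_graph_adj (sym_group 624) r s"
    then have rs: "prime r" "prime s" "r \<noteq> s" "r + s \<le> 624"
      by (auto simp: prime_graph_adj_sym_group)
    then obtain x where x: "x \<in> carrier (sym_group 624)" "S.ord x = r * s"
      using sym_group_ex_ord_prime_prod by blast
    have "group.ord ?H (x, \<one>\<^bsub>K\<^esub>) = r * s" "(x, \<one>\<^bsub>K\<^esub>) \<in> carrier ?H"
      using x by (simp_all add: ord)
    then show "prime_graph_adj ?H r s"
      using rs by (auto simp: prime_graph_adj_def verts prime_graph_verts_sym_group)
  next
    assume "prime_graph_adj ?H r s"
    then obtain x y where rs: "prime r" "prime s" "r \<noteq> s" "r \<le> 625" "s \<le> 625"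
      and x: "x \<in> carrier (sym_group 624)" and y: "y \<in> carrier K"
      and o: "lcm (S.ord x) (K.ord y) = r * s"
      by (auto simp: prime_graph_adj_def verts prime_graph_verts_sym_group ord)
    have "r + s \<le> 624"
    proof (cases "r = 5 \<or> s = 5")
      case True
      \<comment> \<open>The other prime is at most 619, so the sum is at most 624 whatever the
        element is.\<close>
      then show ?thesis using True prime_le_625D[OF rs(1,4)] prime_le_625D[OF rs(2,5)] by auto
    next
      case False
      \<comment> \<open>The order of \<open>y\<close> divides both 5^4 and r * s, which are coprime,
        so \<open>x\<close> alone carries the order r * s.\<close>
      have "K.ord y dvd 5 ^ 4"
        using K.ord_dvd_group_order[OF y] K(2) by simp
      moreover have "K.ord y dvd r * s" using o by (metis dvd_lcm2)
      moreover have "coprime (5 ^ 4) (r * s)"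
      proof -
        have "prime (5::nat)" by simp
        then have "coprime 5 r" "coprime 5 s"
          using False rs(1,2) primes_coprime by metis+
        then show ?thesis by (intro coprime_power_left_iff[THEN iffD2] disjI1) simp
      qed
      ultimately have "K.ord y = 1"
        by (metis coprime_common_divisor nat_dvd_1_iff_1)
      then have "S.ord x = r * s" using o by simp
      then show ?thesis using sum_le_if_ord_eq_prime_prod rs x by blast
    qed
    with rs(1-3) show "prime_graph_adj (sym_group 624) r s"
      unfolding prime_graph_adj_sym_group by blast
  }
qed

lemma degree_pattern_sym_group_624_DirProd:
  assumes "group K" "order K = 625"
  shows "degree_pattern (sym_group 624 \<times>\<times> K) = degree_pattern (sym_group 625)"
proof -
  have "prime_graph_degree (sym_group 624 \<times>\<times> K) = prime_graph_degree (sym_group 625)"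
    unfolding prime_graph_degree_def prime_graph_adj_sym_group_624_DirProd[OF assms]
      prime_graph_adj_sym_group_625_iff ..
  then show ?thesis
    by (simp only: degree_pattern_def prime_graph_verts_def order_sym_group_624_DirProd[OF assms(2)])
qed

section \<open>Central torsion\<close>

text \<open>An isomorphism invariant that forgets the factor S_624 and sees only the centre of
  \<open>K\<close>.\<close>

definition central_torsion :: "('a, 'b) monoid_scheme \<Rightarrow> nat \<Rightarrow> 'a set" where
  "central_torsion G m =
     {z \<in> carrier G. (\<forall>g\<in>carrier G. z \<otimes>\<^bsub>G\<^esub> g = g \<otimes>\<^bsub>G\<^esub> z) \<and> z [^]\<^bsub>G\<^esub> m = \<one>\<^bsub>G\<^esub>}"

text \<open>For an abelian group of order 5^4, the first count gives the number of nontrivial cyclic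
  factors, and the quotient of the two gives the number of factors of order at least 25. Neither
  count alone separates all five groups.\<close>

definition torsion_type :: "('a, 'b) monoid_scheme \<Rightarrow> nat \<times> nat" where
  "torsion_type G = (card (central_torsion G 5), card (central_torsion G 25))"

lemma card_central_torsion_iso:
  assumes "group G" "group H" "G \<cong> H"
  shows "card (central_torsion G m) = card (central_torsion H m)"
proof -
  obtain h where h: "h \<in> iso G H" using assms(3) by (auto simp: is_iso_def)
  then have hom: "h \<in> hom G H" and bij: "bij_betw h (carrier G) (carrier H)"
    by (auto simp: iso_def)
  interpret group_hom G H h
    using assms hom by (simp add: group_hom_def group_hom_axioms_def)
  have inj: "inj_on h (carrier G)" and im: "carrier H = h ` carrier G"
    using bij by (auto simp: bij_betw_def)
  have eq: "h x = h y \<longleftrightarrow> x = y" if "x \<in> carrier G" "y \<in> carrier G" for x y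
    using inj that by (auto simp: inj_on_def)
  have "h z \<in> central_torsion H m \<longleftrightarrow> z \<in> central_torsion G m" if z: "z \<in> carrier G" for z
  proof -
    have "h z \<otimes>\<^bsub>H\<^esub> h g = h g \<otimes>\<^bsub>H\<^esub> h z \<longleftrightarrow> z \<otimes>\<^bsub>G\<^esub> g = g \<otimes>\<^bsub>G\<^esub> z" if "g \<in> carrier G" for g
      using eq[of "z \<otimes>\<^bsub>G\<^esub> g" "g \<otimes>\<^bsub>G\<^esub> z"] that z by simp
    moreover have "h z [^]\<^bsub>H\<^esub> m = \<one>\<^bsub>H\<^esub> \<longleftrightarrow> z [^]\<^bsub>G\<^esub> m = \<one>\<^bsub>G\<^esub>"
      using eq[of "z [^]\<^bsub>G\<^esub> m" "\<one>\<^bsub>G\<^esub>"] z by (simp add: hom_nat_pow)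
    ultimately show ?thesis using z by (auto simp: central_torsion_def im)
  qed
  moreover have "central_torsion G m \<subseteq> carrier G" "central_torsion H m \<subseteq> h ` carrier G"
    by (auto simp: central_torsion_def im)
  ultimately have "central_torsion H m = h ` central_torsion G m"
    by blast
  moreover have "inj_on h (central_torsion G m)"
    using inj by (rule inj_on_subset) (auto simp: central_torsion_def)
  ultimately show ?thesis by (simp add: card_image)
qed

lemma central_torsion_DirProd:
  assumes "group G" "group H"
  shows "central_torsion (G \<times>\<times> H) m = central_torsion G m \<times> central_torsion H m"
proof -
  \<comment> \<open>Commuting with all pairs splits into one condition per coordinate because
    neither carrier is empty.\<close>
  have "\<one>\<^bsub>G\<^esub> \<in> carrier G" "\<one>\<^bsub>H\<^esub> \<in> carrier H"
    using assms by (simp_all add: group.is_monoid)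
  then show ?thesis
    unfolding central_torsion_def by (auto simp: DirProd_pow)
qed

text \<open>If z moves i, a transposition of z i with a third point k fixes i but moves z i, so it
  does not commute with z. The bound on \<open>n\<close> supplies k.\<close>

lemma central_torsion_sym_group:
  assumes "n \<ge> 3"
  shows "central_torsion (sym_group n) m = {id}"
proof -
  have "z = id" if "z \<in> central_torsion (sym_group n) m" for z
  proof (rule ccontr)
    have z: "z permutes {1..n}" and comm: "\<And>t. t permutes {1..n} \<Longrightarrow> z \<circ> t = t \<circ> z"
      using that by (auto simp: central_torsion_def sym_group_def)
    assume "z \<noteq> id"
    then obtain i where i: "z i \<noteq> i" by (auto simp: fun_eq_iff)
    then have "i \<in> {1..n}" using z by (auto simp: permutes_def)
    then have zi: "z i \<in> {1..n}" using z by (simp add: permutes_in_image del: atLeastAtMost_iff)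
    have "card {i, z i} = 2" using i by simp
    then have "\<not> {1..n} \<subseteq> {i, z i}" using card_mono[of "{i, z i}" "{1..n}"] assms by auto
    then obtain k where k: "k \<in> {1..n}" "k \<noteq> i" "k \<noteq> z i" by blast
    have "z \<circ> transpose (z i) k = transpose (z i) k \<circ> z"
      using zi k(1) by (intro comm permutes_swap_id)
    then have "z (transpose (z i) k i) = transpose (z i) k (z i)" by (metis comp_apply)
    then show False using i k by (simp add: transpose_def split: if_splits)
  qed
  moreover have "id \<in> central_torsion (sym_group n) m"
    by (simp add: central_torsion_def sym_group_pow) (simp add: sym_group_def permutes_id)
  ultimately show ?thesis by blast
qed

lemma card_central_torsion_integer_mod_group:
  assumes "a > 0"
  shows "card (central_torsion (integer_mod_group a) m) = gcd a m"
proof -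
  define g where "g = gcd a m"
  obtain e f where e: "a = g * e" and f: "m = g * f" and ef: "coprime e f"
    using gcd_coprime_exists[of a m] assms unfolding g_def by (metis gcd_pos_nat less_irrefl mult.commute)
  have pos: "g > 0" "e > 0" using e assms by auto
  \<comment> \<open>Cancelling g = gcd a m leaves e = a / g coprime to f = m / g, so the m-torsion
    consists of the multiples of e; there are g of them in {0..<a}.\<close>
  have "(int m * z) mod int a = 0 \<longleftrightarrow> int e dvd z" for z
  proof -
    have "int a dvd int m * z \<longleftrightarrow> int e dvd int f * z"
      using pos by (simp add: e f mult.assoc)
    also have "\<dots> \<longleftrightarrow> int e dvd z"
      using ef by (simp add: coprime_dvd_mult_right_iff)
    finally show ?thesis by auto
  qed
  then have "central_torsion (integer_mod_group a) m = {z \<in> {0..<int a}. int e dvd z}"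
    using assms by (auto simp: central_torsion_def carrier_integer_mod_group add.commute)
  also have "\<dots> = (\<lambda>k. int e * int k) ` {..<g}"
  proof (intro equalityI subsetI)
    fix z assume z: "z \<in> {z \<in> {0..<int a}. int e dvd z}"
    then obtain k where "z = int e * k" by (auto elim: dvdE)
    with z have k: "z = int e * k" "0 \<le> int e * k" "int e * k < int e * int g"
      by (auto simp: e mult.commute)
    then have "k \<ge> 0" "k < int g" using pos by (auto simp: zero_le_mult_iff)
    then show "z \<in> (\<lambda>k. int e * int k) ` {..<g}"
      using k(1) by (intro image_eqI[of _ _ "nat k"]) auto
  next
    fix z assume "z \<in> (\<lambda>k. int e * int k) ` {..<g}"
    then show "z \<in> {z \<in> {0..<int a}. int e dvd z}"
      using pos by (auto simp: e mult.commute)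
  qed
  finally show ?thesis
    using pos by (simp add: card_image inj_on_def g_def)
qed

section \<open>Counting isomorphism classes\<close>

lemma prime_graph_adj_iso:
  assumes "group G" "group H" "G \<cong> H" "prime_graph_adj G r s"
  shows "prime_graph_adj H r s"
proof -
  interpret H: group H by fact
  obtain h where h: "h \<in> iso G H" using assms(3) by (auto simp: is_iso_def)
  have "order G = order H" using iso_same_card[OF assms(3)] by (simp add: order_def)
  moreover obtain x where x: "x \<in> carrier G" "group.ord G x = r * s"
    using assms(4) by (auto simp: prime_graph_adj_def)
  interpret G: group G by fact
  have hx: "h x \<in> carrier H" using h x by (auto simp: iso_def hom_def)
  have "h x [^]\<^bsub>H\<^esub> k = \<one>\<^bsub>H\<^esub> \<longleftrightarrow> x [^]\<^bsub>G\<^esub> k = \<one>\<^bsub>G\<^esub>" for k :: nat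
  proof -
    have hom: "h \<in> hom G H" and inj: "inj_on h (carrier G)"
      using h by (auto simp: iso_def bij_betw_def)
    have "h (x [^]\<^bsub>G\<^esub> k) = h \<one>\<^bsub>G\<^esub> \<longleftrightarrow> x [^]\<^bsub>G\<^esub> k = \<one>\<^bsub>G\<^esub>"
      using inj x by (intro inj_on_eq_iff) auto
    then show ?thesis
      using hom x assms(1,2) by (simp add: hom_nat_pow hom_one)
  qed
  then have "group.ord H (h x) = r * s"
    using x hx by (simp add: H.ord_unique G.pow_eq_id)
  ultimately show ?thesis
    using hx assms(4) by (auto simp: prime_graph_adj_def prime_graph_verts_def)
qed

lemma degree_pattern_iso:
  assumes "group G" "group H" "G \<cong> H"
  shows "degree_pattern G = degree_pattern H"
proof -
  have "prime_graph_adj G = prime_graph_adj H"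
    using prime_graph_adj_iso[OF assms]
      prime_graph_adj_iso[OF assms(2,1) group.iso_sym[OF assms(1,3)]]
    by (intro ext iffI)
  moreover have "order G = order H" using iso_same_card[OF assms(3)] by (simp add: order_def)
  ultimately show ?thesis
    by (simp add: degree_pattern_def prime_graph_verts_def prime_graph_degree_def)
qed

text \<open>\<open>h_OD\<close> counts only groups on natural numbers, so \<open>H\<close>, of
  arbitrary type, enters through an isomorphic copy on {..<order H}.\<close>

lemma quotient_OD_groups_mem:
  assumes "group H" "finite (carrier H)" "order H = order G" "degree_pattern H = degree_pattern G"
  shows "\<exists>X\<in>OD_groups G // OD_iso_rel G. \<forall>K\<in>X. group K \<and> H \<cong> K"
proof -
  obtain f :: "nat \<times> nat \<Rightarrow> nat" and e :: nat
    where "group \<lparr>carrier = {..<order H}, mult = \<lambda>x y. f (x, y), one = e\<rparr>"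
      and "H \<cong> \<lparr>carrier = {..<order H}, mult = \<lambda>x y. f (x, y), one = e\<rparr>"
    by (rule finite_group_iso_nat[OF assms(1,2)])
  then obtain T :: "nat monoid" where T: "group T" "H \<cong> T" by blast
  have "T \<in> OD_groups G"
    using T assms iso_same_card[OF T(2)] iso_finite[OF T(2)] degree_pattern_iso[OF assms(1) T]
    by (simp add: OD_groups_def order_def)
  then have "OD_iso_rel G `` {T} \<in> OD_groups G // OD_iso_rel G"
    by (rule quotientI)
  moreover have "group K \<and> H \<cong> K" if "K \<in> OD_iso_rel G `` {T}" for K
    using that T(2) iso_trans by (auto simp: OD_iso_rel_def OD_groups_def)
  ultimately show ?thesis by blast
qed

text \<open>Isomorphic groups share their torsion type, so the choice of a representative is
  harmless, and distinct torsion types force distinct classes.\<close>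

lemma torsion_type_in_image_OD_classes:
  assumes "group H" "finite (carrier H)" "order H = order G" "degree_pattern H = degree_pattern G"
  shows "torsion_type H \<in> (\<lambda>X. torsion_type (SOME K. K \<in> X)) ` (OD_groups G // OD_iso_rel G)"
proof -
  obtain X where X: "X \<in> OD_groups G // OD_iso_rel G" "\<forall>K\<in>X. group K \<and> H \<cong> K"
    using quotient_OD_groups_mem[OF assms] by blast
  define T where "T = (SOME K. K \<in> X)"
  have "X \<noteq> {}" using equiv_OD_iso_rel X(1) by (rule in_quotient_imp_non_empty)
  then have "T \<in> X" by (simp add: T_def some_in_eq)
  then have "group T" "H \<cong> T" using X(2) by auto
  then have "torsion_type H = torsion_type T"
    unfolding torsion_type_def by (simp only: card_central_torsion_iso[OF assms(1)])
  then show ?thesis using X(1) unfolding T_def by (rule image_eqI)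
qed

section \<open>The abelian groups of order 625 and the final count\<close>

text \<open>Shorter products take the trivial group \<open>integer_mod_group 1\<close> in the
  remaining places, so one type and one computation serve all five groups.\<close>

definition cyclic_product4 :: "nat \<Rightarrow> nat \<Rightarrow> nat \<Rightarrow> nat \<Rightarrow> (int \<times> int \<times> int \<times> int) monoid" where
  "cyclic_product4 a b c d = integer_mod_group a \<times>\<times>
     (integer_mod_group b \<times>\<times> (integer_mod_group c \<times>\<times> integer_mod_group d))"

theorem corollary1p10:
  shows "h_OD (sym_group 625) \<ge> 6 \<and>
    \<not> (\<forall>m::nat. m \<ge> 1 \<and> m \<noteq> 10 \<longrightarrow>
          (\<exists>n\<in>{1, 3}. fold_OD_characterizable n (sym_group m)))"
proof -
  let ?G = "sym_group 625"
  let ?Q = "OD_groups ?G // OD_iso_rel ?G"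
  define \<Phi> where "\<Phi> X = torsion_type (SOME K. K \<in> X)" for X :: "nat monoid set"
  note mem = torsion_type_in_image_OD_classes[of _ ?G, folded \<Phi>_def]
  have "torsion_type ?G \<in> \<Phi> ` ?Q"
  proof -
    have "finite (carrier ?G)"
      by (simp add: sym_group_def finite_permutations)
    then show ?thesis
      using sym_group_is_group by (intro mem refl)
  qed
  moreover have "torsion_type ?G = (1, 1)"
    by (simp add: torsion_type_def central_torsion_sym_group)
  moreover have "(gcd a 5 * gcd b 5 * gcd c 5 * gcd d 5, gcd a 25 * gcd b 25 * gcd c 25 * gcd d 25)
      \<in> \<Phi> ` ?Q" if abcd: "a * b * c * d = 625" for a b c d
  proof -
    let ?K = "cyclic_product4 a b c d"
    let ?H = "sym_group 624 \<times>\<times> ?K"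
    \<comment> \<open>A zero factor would make the product 0; it must be excluded because
      \<open>integer_mod_group 0\<close> is infinite.\<close>
    have pos: "a > 0" "b > 0" "c > 0" "d > 0" using abcd by (auto intro: ccontr)
    have K: "group ?K" by (simp add: cyclic_product4_def DirProd_group)
    have H: "group ?H" using sym_group_is_group K by (rule DirProd_group)
    have ordK: "order ?K = 625"
      using pos abcd
      by (simp add: cyclic_product4_def order_DirProd mult.assoc)
        (simp add: order_def carrier_integer_mod_group mult.assoc)
    have "finite (carrier ?H)"
      using pos by (simp add: sym_group_def finite_permutations cyclic_product4_def carrier_integer_mod_group)
    with H have "torsion_type ?H \<in> \<Phi> ` ?Q"
      using order_sym_group_624_DirProd[OF ordK] degree_pattern_sym_group_624_DirProd[OF K ordK]
      by (rule mem)
    moreover have "card (central_torsion ?H m) = gcd a m * gcd b m * gcd c m * gcd d m" for m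
      using pos sym_group_is_group
      by (simp add: cyclic_product4_def central_torsion_DirProd DirProd_group card_cartesian_product
          central_torsion_sym_group card_central_torsion_integer_mod_group)
    ultimately show ?thesis by (simp add: torsion_type_def)
  qed
  \<comment> \<open>The five factorisations correspond to the partitions of 4: 4, 3+1, 2+2, 2+1+1,
    1+1+1+1.\<close>
  from this[of 625 1 1 1] this[of 125 5 1 1] this[of 25 25 1 1] this[of 25 5 5 1] this[of 5 5 5 5]
  have "(5, 25) \<in> \<Phi> ` ?Q" "(25, 125) \<in> \<Phi> ` ?Q" "(25, 625) \<in> \<Phi> ` ?Q" "(125, 625) \<in> \<Phi> ` ?Q"
    "(625, 625) \<in> \<Phi> ` ?Q"
    by (simp_all add: gcd_non_0_nat)
  ultimately have "{(1, 1), (5, 25), (25, 125), (25, 625), (125, 625), (625, 625)} \<subseteq> \<Phi> ` ?Q"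
    by simp
  \<comment> \<open>Six distinct values in the image of \<open>\<Phi>\<close> need at least six
    classes; the comparison of cardinalities rests on there being finitely many classes.\<close>
  then have "card {(1, 1), (5, 25), (25, 125), (25, 625), (125, 625), (625, 625) :: nat \<times> nat}
      \<le> card ?Q"
    using surj_card_le[OF finite_OD_classes] by blast
  then have ge: "h_OD ?G \<ge> 6"
    by (simp add: h_OD_def)
  then have "\<not> (\<exists>n\<in>{1, 3}. fold_OD_characterizable n ?G)"
    by (auto simp: fold_OD_characterizable_def)
  then have "\<not> (\<forall>m::nat. m \<ge> 1 \<and> m \<noteq> 10 \<longrightarrow>
          (\<exists>n\<in>{1, 3}. fold_OD_characterizable n (sym_group m)))"
    by (intro notI) (erule allE[of _ 625], simp)
  with ge show ?thesis by blast
qed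

end
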